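(* Let $P\in\mathcal{L}(n)$ with atoms $a_1,\dots,a_n$ and top element $\hat 1$, and let $\mathcal{C}$ be the labeling $m_p=\prod_{a_i\in\mathrm{supp}(p)}a_i$ for $p\in P\setminus\{0\}$ (where each atom $a_i$ is also regarded as a variable of the polynomial ring $K[a_1,\dots,a_n]$ over a field $K$). Suppose that for every $p\in P\setminus(\mathrm{atoms}(P)\cup\{0\})$ there exist $a_i,a_j\in\mathrm{supp}(p)$ with $p=a_i\vee a_j$ and a fixed $r\in\{i,j\}$ such that $N([a_r\vee a_k,\hat 1])<N([p,\hat 1])$ for every $a_k\in\mathrm{atoms}(P)\setminus\mathrm{supp}(p)$. Then $\mathcal{C}$ is a weak coordinatization of $P$.
   Context: $\mathcal{L}(n)$ denotes the set of finite atomic lattices with $n$ atoms; a finite atomic lattice is a finite lattice with least element $0$ and greatest element $\hat 1$ in which every nonzero element is a join of atoms. $\mathrm{supp}(p)=\{a\in\mathrm{atoms}(P): a\le p\}$; $[a,b]=\{p\in P: a\le p\le b\}$ and $N([a,b])=|[a,b]|$. For $p\in P$, $\lceil p\rceil=\{q:q\ge p\}$, $\lceil p\rceil^c=P\setminus\lceil p\rceil$. A labeling assigns monomials $m_p$ to elements (here $m_0=1$). Conventions: $\mathrm{lcm}\,\emptyset=\gcd\emptyset=1$. For an atom $a$ let $x(a)=\prod_{p\in\lceil a\rceil^c}m_p$. For $p\in P$ let $B_p=\{T\subseteq\mathrm{supp}(p):\bigvee_{b\in T}b=p\}$, and for an atom $a$ let $\triangle(a)=\gcd\{\mathrm{lcm}\{x(b):b\in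 T\}:T\in\bigcup_{q\ge a}B_q\}$; $I_{P,\mathcal{C}}$ is the monomial ideal generated by all $\triangle(a)$. The lcm-lattice $LCM(I)$ of a monomial ideal $I$ is the set of least common multiples of subsets of its minimal generators, ordered by divisibility. The labeling is a weak coordinatization of $P$ if there is a lattice isomorphism $g:P\to LCM(I_{P,\mathcal{C}})$ with $g(a)=\triangle(a)$ for every atom $a$.
   Formalization: The case n = 1 is excluded: for P = {0 < a} the hypothesis is vacuous but x(a) = m_0 = 1, so △(a) = 1 and LCM(I) = {1} has one element while P has two, and the claim fails there. *)

theory Defs
  imports
    "HOL-Library.Finite_Lattice"
    "HOL-Library.Multiset"
    "HOL-Library.Poly_Mapping"
    "HOL-Algebra.Ideal"
begin

section \<open>Finite atomic lattices\<close>

definition atoms :: "'p::finite_lattice_complete set" where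
  "atoms = {a. bot < a \<and> (\<nexists>p. bot < p \<and> p < a)}"

definition atomic_lattice :: "'p::finite_lattice_complete itself \<Rightarrow> bool" where
  "atomic_lattice P \<longleftrightarrow> (\<forall>p::'p. p \<noteq> bot \<longrightarrow> (\<exists>A\<subseteq>atoms. p = Sup A))"

definition supp :: "'p::finite_lattice_complete \<Rightarrow> 'p set" where
  "supp p = {a \<in> atoms. a \<le> p}"

definition N_interval :: "'p::finite_lattice_complete \<Rightarrow> 'p \<Rightarrow> nat" where
  "N_interval a b = card {a..b}"

definition filter_of :: "'p::finite_lattice_complete \<Rightarrow> 'p set" where
  "filter_of p = {q. p \<le> q}"


section \<open>Monomials and monomial ideals\<close>

text \<open>
  A monomial in the variables \<^typ>\<open>'v\<close> is the finite multiset of its variable factors. Hence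
  the monomial 1 is \<^term>\<open>{#}\<close>, the product is the sum of multisets, divisibility is
  \<^term>\<open>(\<subseteq>#)\<close>, and the lcm and gcd of a finite set of monomials are \<^const>\<open>Sup\<close> and
  \<^const>\<open>Inf\<close>; both of these are \<^term>\<open>{#}\<close> on the empty set.

  Polynomials over a field are finitely supported functions from monomials to the field, with the
  convolution product. The ring \<open>K[V]\<close> consists of those in which only variables from \<open>V\<close> occur.
\<close>

type_synonym 'v monomial = "'v multiset"
type_synonym ('v, 'k) mpoly = "'v monomial \<Rightarrow>\<^sub>0 'k"

definition monomials_in :: "'v set \<Rightarrow> 'v monomial set" where
  "monomials_in V = {t. set_mset t \<subseteq> V}"

definition poly_ring :: "'v set \<Rightarrow> ('v, 'k::field) mpoly ring" where
  "poly_ring V =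
     \<lparr>carrier = {f. Poly_Mapping.keys f \<subseteq> monomials_in V},
      monoid.mult = (*), one = 1, ring.zero = 0, add = (+)\<rparr>"

definition monomial_ideal :: "'v set \<Rightarrow> 'v monomial set \<Rightarrow> ('v, 'k::field) mpoly set" where
  "monomial_ideal V G = genideal (poly_ring V) ((\<lambda>t. Poly_Mapping.single t 1) ` G)"

definition generates :: "'v set \<Rightarrow> 'v monomial set \<Rightarrow> ('v, 'k::field) mpoly set \<Rightarrow> bool" where
  "generates V G I \<longleftrightarrow> G \<subseteq> monomials_in V \<and> monomial_ideal V G = I"

text \<open>Every monomial ideal has exactly one minimal set of monomial generators.\<close>

definition min_gens :: "'v set \<Rightarrow> ('v, 'k::field) mpoly set \<Rightarrow> 'v monomial set" where
  "min_gens V I = (THE G. generates V G I \<and> (\<forall>H. H \<subset> G \<longrightarrow> \<not> generates V H I))"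

definition lcm_lattice :: "'v set \<Rightarrow> ('v, 'k::field) mpoly set \<Rightarrow> 'v monomial set" where
  "lcm_lattice V I = {Sup S | S. S \<subseteq> min_gens V I}"


section \<open>Isomorphisms onto a lattice of monomials ordered by divisibility\<close>

definition is_join_in :: "'v monomial set \<Rightarrow> 'v monomial \<Rightarrow> 'v monomial \<Rightarrow> 'v monomial \<Rightarrow> bool" where
  "is_join_in L s t u \<longleftrightarrow>
     u \<in> L \<and> s \<subseteq># u \<and> t \<subseteq># u \<and> (\<forall>w\<in>L. s \<subseteq># w \<and> t \<subseteq># w \<longrightarrow> u \<subseteq># w)"

definition is_meet_in :: "'v monomial set \<Rightarrow> 'v monomial \<Rightarrow> 'v monomial \<Rightarrow> 'v monomial \<Rightarrow> bool" where
  "is_meet_in L s t u \<longleftrightarrow>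
     u \<in> L \<and> u \<subseteq># s \<and> u \<subseteq># t \<and> (\<forall>w\<in>L. w \<subseteq># s \<and> w \<subseteq># t \<longrightarrow> w \<subseteq># u)"

definition lattice_iso_onto ::
    "('p::finite_lattice_complete \<Rightarrow> 'v monomial) \<Rightarrow> 'v monomial set \<Rightarrow> bool" where
  "lattice_iso_onto g L \<longleftrightarrow>
     bij_betw g UNIV L \<and>
     (\<forall>p q. is_join_in L (g p) (g q) (g (sup p q))) \<and>
     (\<forall>p q. is_meet_in L (g p) (g q) (g (inf p q)))"


section \<open>Labelings and weak coordinatizations\<close>

definition labeling :: "'v set \<Rightarrow> ('p::finite_lattice_complete \<Rightarrow> 'v monomial) \<Rightarrow> bool" where
  "labeling V m \<longleftrightarrow> m bot = {#} \<and> range m \<subseteq> monomials_in V"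

definition x_mono :: "('p::finite_lattice_complete \<Rightarrow> 'v monomial) \<Rightarrow> 'p \<Rightarrow> 'v monomial" where
  "x_mono m a = (\<Sum>p\<in>- filter_of a. m p)"

definition B_sets :: "'p::finite_lattice_complete \<Rightarrow> 'p set set" where
  "B_sets p = {T. T \<subseteq> supp p \<and> Sup T = p}"

definition triangle :: "('p::finite_lattice_complete \<Rightarrow> 'v monomial) \<Rightarrow> 'p \<Rightarrow> 'v monomial" where
  "triangle m a = Inf {Sup (x_mono m ` T) | T. T \<in> (\<Union>q\<in>filter_of a. B_sets q)}"

definition ideal_of_labeling ::
    "'v set \<Rightarrow> ('p::finite_lattice_complete \<Rightarrow> 'v monomial) \<Rightarrow> ('v, 'k::field) mpoly set" where
  "ideal_of_labeling V m = monomial_ideal V (triangle m ` atoms)"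

definition weak_coordinatization ::
    "'k::field itself \<Rightarrow> 'v set \<Rightarrow> ('p::finite_lattice_complete \<Rightarrow> 'v monomial) \<Rightarrow> bool" where
  "weak_coordinatization K V m \<longleftrightarrow>
     labeling V m \<and>
     (\<exists>g. lattice_iso_onto g (lcm_lattice V (ideal_of_labeling V m :: ('v, 'k) mpoly set)) \<and>
          (\<forall>a\<in>atoms. g a = triangle m a))"

text \<open>The atoms themselves are the variables; the empty product at \<^const>\<open>bot\<close> is 1.\<close>

definition support_labeling :: "'p::finite_lattice_complete \<Rightarrow> 'p monomial" where
  "support_labeling p = (\<Sum>a\<in>supp p. {#a#})"

end

theory Submission
  imports Defs
begin

text \<open>
  Write \<open>N q\<close> for the number of elements above \<open>q\<close>. The exponent of the variable \<open>c\<close> in \<open>x(a)\<close> is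
  \<open>N c - N (a \<squnion> c)\<close>. Distributivity of gcd over lcm shows, for every labeling, that \<open>\<triangle>(a)\<close> divides
  \<open>lcm {\<triangle>(b) | b \<in> T}\<close> whenever \<open>a \<le> Sup T\<close>. Hence the labeling is a weak coordinatization as soon
  as \<open>\<triangle>(a)\<close> does not divide \<open>lcm {\<triangle>(b) | b \<in> supp p}\<close> for \<open>a\<close> not below \<open>p\<close>: taking \<open>p\<close> to be an
  atom, this makes the \<open>\<triangle>(a)\<close> an antichain, so they are the minimal generators. The exponent of the
  variable \<open>a\<^sub>r\<close> (or \<open>p\<close>, if \<open>p\<close> is an atom) separates the two monomials: it is at most \<open>N a\<^sub>r - N p\<close>
  in every \<open>\<triangle>(b)\<close> with \<open>b \<le> p\<close>, by taking \<open>T = supp p\<close> in the gcd, while any \<open>T\<close> with \<open>a \<le> Sup T\<close>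
  contains an atom outside \<open>supp p\<close>.
\<close>

section \<open>Minimal generators of monomial ideals\<close>

lemma ring_poly_ring: "ring (poly_ring V :: ('v, 'k::field) mpoly ring)"
proof (rule ringI)
  show "abelian_group (poly_ring V :: ('v, 'k) mpoly ring)"
  proof (rule abelian_groupI)
    fix f h :: "('v, 'k) mpoly"
    assume f: "f \<in> carrier (poly_ring V)"
    show "f \<oplus>\<^bsub>poly_ring V\<^esub> h \<in> carrier (poly_ring V)" if "h \<in> carrier (poly_ring V)"
      using f that Poly_Mapping.keys_add[of f h] by (auto simp: poly_ring_def)
    from f show "\<exists>h\<in>carrier (poly_ring V). h \<oplus>\<^bsub>poly_ring V\<^esub> f = \<zero>\<^bsub>poly_ring V\<^esub>"
      by (intro bexI[of _ "- f"]) (auto simp: poly_ring_def)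
  qed (auto simp: poly_ring_def add.assoc add.commute)
  show "Group.monoid (poly_ring V :: ('v, 'k) mpoly ring)"
  proof (rule monoidI)
    fix f h :: "('v, 'k) mpoly"
    assume "f \<in> carrier (poly_ring V)" "h \<in> carrier (poly_ring V)"
    then show "f \<otimes>\<^bsub>poly_ring V\<^esub> h \<in> carrier (poly_ring V)"
      using keys_mult[of f h] by (fastforce simp: poly_ring_def monomials_in_def)
  qed (auto simp: poly_ring_def monomials_in_def mult.assoc)
qed (auto simp: poly_ring_def distrib_left distrib_right)

text \<open>An upper bound for membership in a monomial ideal. Divisibility by an element of
  \<open>G\<close> survives multiplication because every monomial of \<open>h * f\<close> is a
  product of a monomial of \<open>h\<close> and one of \<open>f\<close>.\<close>

lemma ideal_keys_divisible:
  "ideal {f. Poly_Mapping.keys f \<subseteq> monomials_in V \<inter> {t. \<exists>g\<in>G. g \<subseteq># t}}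
     (poly_ring V :: ('v, 'k::field) mpoly ring)" (is "ideal ?I ?R")
proof (rule idealI[OF ring_poly_ring])
  have add: "f + h \<in> ?I" if "f \<in> ?I" "h \<in> ?I" for f h
    using that Poly_Mapping.keys_add[of f h] by blast
  interpret R: ring ?R by (rule ring_poly_ring)
  show "subgroup ?I (add_monoid ?R)"
  proof (rule group.subgroupI)
    show "group (add_monoid ?R)" by (rule R.add.is_group)
    show "?I \<subseteq> carrier (add_monoid ?R)" by (auto simp: poly_ring_def)
    show "?I \<noteq> {}" by (auto intro!: exI[of _ 0])
    fix f assume f: "f \<in> ?I"
    \<comment> \<open>The ring record stores no negation, so \<open>- f\<close> is identified by
      uniqueness of additive inverses.\<close>
    then have "\<ominus>\<^bsub>?R\<^esub> f = - f"
      by (intro R.minus_equality) (auto simp: poly_ring_def)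
    then show "inv\<^bsub>add_monoid ?R\<^esub> f \<in> ?I" using f by (simp add: a_inv_def)
    fix h assume "h \<in> ?I"
    then show "f \<otimes>\<^bsub>add_monoid ?R\<^esub> h \<in> ?I" using add f by (simp add: poly_ring_def)
  qed
  fix f h assume f: "f \<in> ?I" and h: "h \<in> carrier ?R"
  show "h \<otimes>\<^bsub>?R\<^esub> f \<in> ?I" and "f \<otimes>\<^bsub>?R\<^esub> h \<in> ?I"
  proof -
    have *: "h * f \<in> ?I"
    proof (intro CollectI subsetI)
      fix t assume "t \<in> Poly_Mapping.keys (h * f)"
      then obtain u v where t: "t = u + v" "u \<in> Poly_Mapping.keys h" "v \<in> Poly_Mapping.keys f"
        using keys_mult[of h f] by blast
      with f h obtain g where "g \<in> G" "g \<subseteq># v" "v \<in> monomials_in V" "u \<in> monomials_in V"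
        unfolding poly_ring_def by fastforce
      with t show "t \<in> monomials_in V \<inter> {t. \<exists>g\<in>G. g \<subseteq># t}"
        by (auto simp: monomials_in_def intro!: bexI[of _ g] subset_mset.add_increasing)
    qed
    then show "h \<otimes>\<^bsub>?R\<^esub> f \<in> ?I" by (simp add: poly_ring_def)
    from * show "f \<otimes>\<^bsub>?R\<^esub> h \<in> ?I" by (simp add: poly_ring_def mult.commute)
  qed
qed

lemma single_in_monomial_ideal_iff:
  assumes "G \<subseteq> monomials_in V" and t: "t \<in> monomials_in V"
  shows "(Poly_Mapping.single t 1 :: ('v, 'k::field) mpoly) \<in> monomial_ideal V G
           \<longleftrightarrow> (\<exists>g\<in>G. g \<subseteq># t)"
proof
  let ?I = "{f :: ('v, 'k) mpoly. Poly_Mapping.keys f \<subseteq> monomials_in V \<inter> {t. \<exists>g\<in>G. g \<subseteq># t}}"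
  assume "(Poly_Mapping.single t 1 :: ('v, 'k) mpoly) \<in> monomial_ideal V G"
  moreover have "(\<lambda>t. Poly_Mapping.single t 1) ` G \<subseteq> ?I"
    using assms(1) by auto
  \<comment> \<open>The generated ideal is the intersection of all ideals containing the generators,
    and \<open>?I\<close> is one of them.\<close>
  ultimately have "Poly_Mapping.single t 1 \<in> ?I"
    using ideal_keys_divisible[of V G] unfolding monomial_ideal_def genideal_def by blast
  then show "\<exists>g\<in>G. g \<subseteq># t" by simp
next
  assume "\<exists>g\<in>G. g \<subseteq># t"
  then obtain g where g: "g \<in> G" "g \<subseteq># t" by blast
  have "t - g \<in> monomials_in V"
    using t by (auto simp: monomials_in_def dest: in_diffD)
  then have c: "Poly_Mapping.single (t - g) 1 \<in> carrier (poly_ring V :: ('v, 'k) mpoly ring)"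
    by (simp add: poly_ring_def)
  have eq: "(Poly_Mapping.single t 1 :: ('v, 'k) mpoly)
      = Poly_Mapping.single (t - g) 1 \<otimes>\<^bsub>poly_ring V\<^esub> Poly_Mapping.single g 1"
    using g(2) by (simp add: poly_ring_def mult_single)
  have "Poly_Mapping.single t 1 \<in> J"
    if "ideal J (poly_ring V :: ('v, 'k) mpoly ring)" "Poly_Mapping.single g 1 \<in> J" for J
    unfolding eq using ideal.I_l_closed[OF that c] .
  then show "(Poly_Mapping.single t 1 :: ('v, 'k) mpoly) \<in> monomial_ideal V G"
    using g(1) unfolding monomial_ideal_def genideal_def by auto
qed

text \<open>Any set \<open>H\<close> generating the same ideal contains \<open>G\<close>: some
  \<open>h\<close> in \<open>H\<close> divides a given \<open>g\<close>, some \<open>g'\<close> in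
  \<open>G\<close> divides \<open>h\<close>, and the antichain condition forces
  \<open>g' = h = g\<close>. So \<open>G\<close> is the least generating set, hence the only minimal
  one, and \<open>THE\<close> selects it.\<close>

lemma min_gens_antichain:
  assumes G: "G \<subseteq> monomials_in V"
    and antichain: "\<And>g h. g \<in> G \<Longrightarrow> h \<in> G \<Longrightarrow> g \<subseteq># h \<Longrightarrow> g = h"
  shows "min_gens V (monomial_ideal V G :: ('v, 'k::field) mpoly set) = G"
proof -
  let ?I = "monomial_ideal V G :: ('v, 'k) mpoly set"
  have divisor: "\<exists>h\<in>H. h \<subseteq># t" if "generates V H ?I" "g \<in> G" "g \<subseteq># t" "t \<in> monomials_in V" for H g t
    using that single_in_monomial_ideal_iff[of _ V t, where ?'k = 'k] G
    unfolding generates_def by metis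
  have divisor': "\<exists>g\<in>G. g \<subseteq># h" if "generates V H ?I" "h \<in> H" for H h
    using that single_in_monomial_ideal_iff[of _ V h, where ?'k = 'k] G
    unfolding generates_def by (metis subset_mset.order_refl subsetD)
  have sub: "G \<subseteq> H" if H: "generates V H ?I" for H
  proof
    fix g assume g: "g \<in> G"
    then obtain h where h: "h \<in> H" "h \<subseteq># g" using divisor[OF H g] G by blast
    then obtain g' where "g' \<in> G" "g' \<subseteq># h" using divisor'[OF H] by blast
    with g h antichain[of g' g] show "g \<in> H" by (metis subset_mset.order_trans subset_mset.antisym)
  qed
  have gen: "generates V G ?I" using G by (simp add: generates_def)
  show ?thesis
    unfolding min_gens_def
  proof (rule the_equality)
    show "generates V G ?I \<and> (\<forall>H. H \<subset> G \<longrightarrow> \<not> generates V H ?I)"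
      using gen sub by blast
  qed (use gen sub in blast)
qed

section \<open>Exponents of lcm and gcd\<close>

text \<open>An lcm takes the largest exponent of each variable. \<open>Sup\<close> of multisets
  defaults to \<open>{#}\<close> on unbounded families, which finiteness excludes.\<close>

lemma count_Sup_le_iff:
  assumes "finite A"
  shows "count (Sup A) c \<le> k \<longleftrightarrow> (\<forall>t\<in>A. count t c \<le> k)"
proof (cases "A = {}")
  case False
  have "count (Sup A) c = (SUP t\<in>A. count t c)"
    using False assms by (intro count_Sup_multiset_nonempty subset_mset.bdd_above_finite)
  then show ?thesis
    using False assms by (simp add: cSUP_le_iff bdd_above_finite)
qed (simp add: Sup_multiset_empty)

lemma count_le_count_Sup: "finite A \<Longrightarrow> t \<in> A \<Longrightarrow> count t c \<le> count (Sup A) c"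
  using count_Sup_le_iff[of A c] by blast

text \<open>A minimum of natural numbers is attained, so a gcd may be replaced by one of its
  members, chosen separately for each variable \<open>c\<close>.\<close>

lemma count_Inf_attained:
  fixes A :: "'v multiset set"
  assumes "A \<noteq> {}"
  shows "\<exists>t\<in>A. count (Inf A) c = count t c"
proof -
  have "count (Inf A) c = (INF t\<in>A. count t c)"
    using assms by (rule count_Inf_multiset_nonempty)
  also have "\<dots> \<in> (\<lambda>t. count t c) ` A"
    using assms by (intro Inf_nat_def1) simp
  finally show ?thesis by blast
qed

lemma Inf_mset_lower: "t \<in> A \<Longrightarrow> Inf A \<subseteq># (t :: 'v multiset)"
  by (rule subset_mset.cInf_lower) auto

section \<open>Weak coordinatizations\<close>

text \<open>\<open>T\<close> can lie in \<open>B_sets q\<close> only for \<open>q = Sup T\<close>,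
  so the union over the filter reduces to the condition \<open>a \<le> Sup T\<close>.\<close>

lemma triangle_candidates:
  "{Sup (x_mono m ` T) | T. T \<in> (\<Union>q\<in>filter_of a. B_sets q)}
     = {Sup (x_mono m ` T) | T. T \<subseteq> atoms \<and> a \<le> Sup T}"
proof -
  have "T \<in> (\<Union>q\<in>filter_of a. B_sets q) \<longleftrightarrow> T \<subseteq> atoms \<and> a \<le> Sup T" for T
    by (auto simp: filter_of_def B_sets_def supp_def intro: Sup_upper)
  then show ?thesis by simp
qed

lemma triangle_dvd: "T \<subseteq> atoms \<Longrightarrow> a \<le> Sup T \<Longrightarrow> triangle m a \<subseteq># Sup (x_mono m ` T)"
  unfolding triangle_def triangle_candidates by (rule Inf_mset_lower) blast

lemma count_triangle_le:
  assumes "T \<subseteq> atoms" "a \<le> Sup T" "\<And>b. b \<in> T \<Longrightarrow> count (x_mono m b) c \<le> k"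
  shows "count (triangle m a) c \<le> k"
proof -
  have "count (triangle m a) c \<le> count (Sup (x_mono m ` T)) c"
    using triangle_dvd[OF assms(1,2)] by (rule mset_subset_eq_count)
  also have "\<dots> \<le> k" using assms(3) by (subst count_Sup_le_iff) auto
  finally show ?thesis .
qed

lemma count_triangle_attained:
  assumes "a \<in> atoms"
  obtains T where "T \<subseteq> atoms" "a \<le> Sup T" "count (triangle m a) c = count (Sup (x_mono m ` T)) c"
proof -
  let ?A = "{Sup (x_mono m ` T) | T. T \<subseteq> atoms \<and> a \<le> Sup T}"
  \<comment> \<open>The gcd must run over a nonempty family for its exponent to be attained;
    \<open>T = {a}\<close> provides a member.\<close>
  have "Sup (x_mono m ` {a}) \<in> ?A" using assms by (intro CollectI exI[of _ "{a}"]) auto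
  then show ?thesis
    using that count_Inf_attained[of ?A c] unfolding triangle_def triangle_candidates by blast
qed

text \<open>For a fixed variable \<open>c\<close>, choose for each \<open>b\<close> in
  \<open>T\<close> a set \<open>U b\<close> attaining the exponent in \<open>triangle m b\<close>.
  The union of these sets has a join above \<open>Sup T\<close>, so it is a candidate for
  \<open>triangle m a\<close>, and its exponents of \<open>c\<close> are bounded by the largest one
  among the \<open>triangle m b\<close>.\<close>

lemma triangle_dvd_Sup_triangle:
  assumes "T \<subseteq> atoms" "a \<le> Sup T"
  shows "triangle m a \<subseteq># Sup (triangle m ` T)"
proof (rule mset_subset_eqI)
  fix c
  have "\<exists>U. U \<subseteq> atoms \<and> b \<le> Sup U \<and> count (triangle m b) c = count (Sup (x_mono m ` U)) c"
    if "b \<in> T" for b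
    using count_triangle_attained[of b m c] assms(1) that by blast
  then obtain U where U: "\<And>b. b \<in> T \<Longrightarrow> U b \<subseteq> atoms" "\<And>b. b \<in> T \<Longrightarrow> b \<le> Sup (U b)"
    "\<And>b. b \<in> T \<Longrightarrow> count (triangle m b) c = count (Sup (x_mono m ` U b)) c"
    by metis
  show "count (triangle m a) c \<le> count (Sup (triangle m ` T)) c"
  proof (rule count_triangle_le)
    show "(\<Union>b\<in>T. U b) \<subseteq> atoms" using U(1) by blast
    have "Sup T \<le> Sup (\<Union>b\<in>T. U b)"
      using U(2) by (intro Sup_least) (meson Sup_subset_mono UN_upper order.trans)
    then show "a \<le> Sup (\<Union>b\<in>T. U b)" using assms(2) by simp
    fix d assume "d \<in> (\<Union>b\<in>T. U b)"
    then obtain b where b: "b \<in> T" "d \<in> U b" by blast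
    then have "count (x_mono m d) c \<le> count (triangle m b) c"
      by (simp add: U(3) count_le_count_Sup)
    also have "\<dots> \<le> count (Sup (triangle m ` T)) c"
      using b by (intro count_le_count_Sup) auto
    finally show "count (x_mono m d) c \<le> count (Sup (triangle m ` T)) c" .
  qed
qed

lemma triangle_in_monomials:
  assumes "labeling V m" "a \<in> atoms"
  shows "triangle m a \<in> monomials_in V"
proof -
  have "triangle m a \<subseteq># x_mono m a"
    using triangle_dvd[of "{a}" a m] assms(2) by simp
  moreover have "x_mono m a \<in> monomials_in V"
    using assms(1) by (auto simp: x_mono_def labeling_def monomials_in_def set_mset_sum)
  ultimately show ?thesis by (auto simp: monomials_in_def dest: mset_subset_eqD)
qed

section \<open>Supports and comparability of atoms\<close>

lemma Sup_supp:
  assumes "atomic_lattice TYPE('p::finite_lattice_complete)"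
  shows "Sup (supp p) = (p::'p)"
proof (rule antisym)
  show "Sup (supp p) \<le> p" by (auto simp: supp_def intro: Sup_least)
  show "p \<le> Sup (supp p)"
  proof (cases "p = bot")
    case False
    then obtain A where "A \<subseteq> atoms" "p = Sup A"
      using assms unfolding atomic_lattice_def by blast
    then have "A \<subseteq> supp p" by (auto simp: supp_def intro: Sup_upper)
    then show ?thesis using \<open>p = Sup A\<close> Sup_subset_mono by blast
  qed simp
qed

lemma atom_le_atom: "a \<in> atoms \<Longrightarrow> b \<in> atoms \<Longrightarrow> a \<le> b \<Longrightarrow> a = b"
  unfolding atoms_def by (auto simp: order.order_iff_strict)

lemma supp_atom: "a \<in> atoms \<Longrightarrow> supp a = {a}"
  by (auto simp: supp_def intro: atom_le_atom)

lemma supp_bot: "supp bot = {}"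
  by (auto simp: supp_def atoms_def bot_unique)

text \<open>The isomorphism sends \<open>p\<close> to the lcm of the generators of the atoms below
  \<open>p\<close>. By \<open>sep\<close> and \<open>triangle_dvd_Sup_triangle\<close>, an atom lies
  below \<open>p\<close> exactly when its generator divides \<open>g p\<close>, and supports
  determine the order.\<close>

lemma weak_coordinatizationI:
  fixes m :: "'p::finite_lattice_complete \<Rightarrow> 'v monomial"
  assumes atomic: "atomic_lattice TYPE('p)" and lab: "labeling V m"
    and sep: "\<And>a p. a \<in> atoms \<Longrightarrow> \<not> a \<le> p \<Longrightarrow> \<not> triangle m a \<subseteq># Sup (triangle m ` supp p)"
  shows "weak_coordinatization TYPE('k::field) V m"
proof -
  define g where "g p = Sup (triangle m ` supp p)" for p
  define L where "L = lcm_lattice V (ideal_of_labeling V m :: ('v, 'k) mpoly set)"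
  have g_atom: "g a = triangle m a" if "a \<in> atoms" for a
    using that by (simp add: g_def supp_atom)
  \<comment> \<open>Since \<open>supp b = {b}\<close> for an atom \<open>b\<close>,
    \<open>sep\<close> compares two generators directly.\<close>
  have "a = b" if "a \<in> atoms" "b \<in> atoms" "triangle m a \<subseteq># triangle m b" for a b
    using sep[of a b] that atom_le_atom[of a b] by (auto simp: supp_atom)
  then have "min_gens V (ideal_of_labeling V m :: ('v, 'k) mpoly set) = triangle m ` atoms"
    unfolding ideal_of_labeling_def
    by (intro min_gens_antichain) (use triangle_in_monomials[OF lab] in blast)+
  then have L: "L = {Sup (triangle m ` T) | T. T \<subseteq> atoms}"
    unfolding L_def lcm_lattice_def by (auto simp: subset_image_iff)
  have atom_iff: "triangle m a \<subseteq># g p \<longleftrightarrow> a \<le> p" if "a \<in> atoms" for a p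
    using sep[OF that] triangle_dvd_Sup_triangle[of "supp p" a m] Sup_supp[OF atomic, of p]
    by (auto simp: g_def supp_def)
  have Sup_dvd: "Sup (triangle m ` T) \<subseteq># t" if "\<And>b. b \<in> T \<Longrightarrow> triangle m b \<subseteq># t" for T t
    using that by (intro mset_subset_eqI) (auto simp: count_Sup_le_iff intro: mset_subset_eq_count)
  have dvd_Sup: "triangle m b \<subseteq># Sup (triangle m ` T)" if "b \<in> T" for T b
    using that by (intro mset_subset_eqI) (auto intro: count_le_count_Sup)
  have iff: "g p \<subseteq># g q \<longleftrightarrow> p \<le> q" for p q
  proof
    assume dvd: "g p \<subseteq># g q"
    have "b \<le> q" if "b \<in> supp p" for b
    proof -
      have "triangle m b \<subseteq># g q"
        using dvd_Sup[OF that] dvd unfolding g_def by (rule subset_mset.order_trans)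
      then show ?thesis using that atom_iff by (simp add: supp_def)
    qed
    then have "Sup (supp p) \<le> q" by (rule Sup_least)
    then show "p \<le> q" by (simp add: Sup_supp[OF atomic])
  next
    assume "p \<le> q"
    then show "g p \<subseteq># g q"
      unfolding g_def by (intro Sup_dvd dvd_Sup) (auto simp: supp_def)
  qed
  have "range g = L"
  proof
    show "range g \<subseteq> L" by (auto simp: g_def L supp_def)
    show "L \<subseteq> range g"
    proof
      fix t assume "t \<in> L"
      then obtain T where T: "T \<subseteq> atoms" "t = Sup (triangle m ` T)" using L by auto
      \<comment> \<open>Atoms of \<open>supp (Sup T)\<close> missing from \<open>T\<close> do not
        enlarge the lcm, since their generators already divide \<open>t\<close>.\<close>
      have "g (Sup T) \<subseteq># t"
        unfolding g_def T(2)
        by (intro Sup_dvd triangle_dvd_Sup_triangle[OF T(1)]) (auto simp: supp_def)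
      moreover have "t \<subseteq># g (Sup T)"
        unfolding g_def T(2)
        by (intro Sup_dvd dvd_Sup) (use T(1) in \<open>auto simp: supp_def intro: Sup_upper\<close>)
      ultimately have "t = g (Sup T)" by (rule subset_mset.antisym[rotated])
      then show "t \<in> range g" by blast
    qed
  qed
  moreover have "inj g"
    by (rule injI) (metis iff antisym subset_mset.order_refl)
  \<comment> \<open>Joins and meets are determined by the order, so a surjective order embedding
    suffices.\<close>
  ultimately have "lattice_iso_onto g L"
    unfolding lattice_iso_onto_def bij_betw_def is_join_in_def is_meet_in_def
    by (auto simp: iff)
  then show ?thesis
    unfolding weak_coordinatization_def L_def using lab g_atom by blast
qed

section \<open>The support labeling\<close>

lemma count_support_labeling:
  "count (support_labeling p) c = (if c \<in> supp p then 1 else 0)"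
  by (simp add: support_labeling_def count_sum)

lemma labeling_support_labeling:
  "labeling (atoms :: 'p::finite_lattice_complete set) support_labeling"
  proof -
  have "set_mset (support_labeling p) = supp p" for p :: 'p
    by (simp add: support_labeling_def set_mset_sum)
  moreover have "support_labeling (bot :: 'p) = {#}"
    by (simp add: support_labeling_def supp_bot)
  ultimately show ?thesis by (auto simp: labeling_def monomials_in_def supp_def)
qed

text \<open>The interval from \<open>c\<close> to the top splits into the elements not above
  \<open>a\<close>, each contributing one factor \<open>c\<close> to x(a), and those above both,
  which form the interval from \<open>sup a c\<close>. The additive form avoids truncated
  subtraction.\<close>

lemma count_x_mono_support_labeling:
  fixes a c :: "'p::finite_lattice_complete"
  assumes "c \<in> atoms"
  shows "count (x_mono support_labeling a) c + N_interval (sup a c) Orderings.top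
           = N_interval c Orderings.top"
proof -
  have "count (x_mono support_labeling a) c
      = (\<Sum>p\<in>- filter_of a. if c \<le> p then 1 else 0)"
    using assms by (simp add: x_mono_def count_sum count_support_labeling supp_def)
  also have "\<dots> = card {p. c \<le> p \<and> \<not> a \<le> p}"
    by (simp add: sum.If_cases filter_of_def Int_def conj_commute)
  finally have "count (x_mono support_labeling a) c + N_interval (sup a c) Orderings.top
      = card ({p. c \<le> p \<and> \<not> a \<le> p} \<union> {p. a \<le> p \<and> c \<le> p})"
    by (subst card_Un_disjoint) (auto simp: N_interval_def intro: arg_cong[where f = card])
  also have "{p. c \<le> p \<and> \<not> a \<le> p} \<union> {p. a \<le> p \<and> c \<le> p} = {c..Orderings.top}"
    by auto
  finally show ?thesis by (simp add: N_interval_def)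
qed

lemma N_interval_antimono:
  fixes p q :: "'p::finite_lattice_complete"
  shows "p \<le> q \<Longrightarrow> N_interval q Orderings.top \<le> N_interval p Orderings.top"
  unfolding N_interval_def by (intro card_mono) auto

lemma N_interval_strict_antimono:
  fixes p q :: "'p::finite_lattice_complete"
  shows "p < q \<Longrightarrow> N_interval q Orderings.top < N_interval p Orderings.top"
  unfolding N_interval_def by (intro psubset_card_mono) auto

text \<open>Leaving \<open>c\<close> free covers both choices of the separating variable:
  \<open>p\<close> itself when \<open>p\<close> is an atom, and the atom supplied by the hypothesis
  otherwise.\<close>

lemma triangle_separation:
  fixes a p c :: "'p::finite_lattice_complete"
  assumes atomic: "atomic_lattice TYPE('p)"
    and a: "a \<in> atoms" "\<not> a \<le> p" and c: "c \<in> supp p"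
    and outside: "\<And>b. b \<in> atoms - supp p \<Longrightarrow>
      N_interval (sup c b) Orderings.top < N_interval p Orderings.top"
  shows "\<not> triangle support_labeling a \<subseteq># Sup (triangle support_labeling ` supp p)"
proof
  let ?N = "\<lambda>q::'p. N_interval q Orderings.top"
  let ?k = "?N c - ?N p"
  have exponent: "count (x_mono support_labeling b) c + ?N (sup c b) = ?N c" for b
    using count_x_mono_support_labeling[of c b] c by (simp add: sup.commute supp_def)
  have "count (triangle support_labeling b) c \<le> ?k" if "b \<in> supp p" for b
  proof (rule count_triangle_le)
    show "supp p \<subseteq> atoms" "b \<le> Sup (supp p)"
      using that Sup_supp[OF atomic, of p] by (auto simp: supp_def)
    show "count (x_mono support_labeling d) c \<le> ?k" if "d \<in> supp p" for d
    proof -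
      have "?N p \<le> ?N (sup c d)"
        using that c by (intro N_interval_antimono) (simp add: supp_def)
      then show ?thesis using exponent[of d] by linarith
    qed
  qed
  then have "count (Sup (triangle support_labeling ` supp p)) c \<le> ?k"
    by (subst count_Sup_le_iff) auto
  moreover assume "triangle support_labeling a \<subseteq># Sup (triangle support_labeling ` supp p)"
  ultimately have small: "count (triangle support_labeling a) c \<le> ?k"
    by (meson mset_subset_eq_count order.trans)
  obtain U where U: "U \<subseteq> atoms" "a \<le> Sup U"
    "count (triangle support_labeling a) c = count (Sup (x_mono support_labeling ` U)) c"
    using count_triangle_attained[OF a(1)] .
  have "\<not> U \<subseteq> supp p"
  proof
    assume "U \<subseteq> supp p"
    then have "Sup U \<le> p" by (auto simp: supp_def intro: Sup_least)
    with U(2) a(2) show False by simp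
  qed
  then obtain b where b: "b \<in> U" "b \<in> atoms - supp p" using U(1) by blast
  have "count (x_mono support_labeling b) c \<le> ?k"
    using small b(1) unfolding U(3)
    by (meson count_le_count_Sup finite finite_imageI imageI order.trans)
  \<comment> \<open>This keeps the subtraction in \<open>?k\<close> from being truncated, so
    \<open>outside\<close> pushes the exponent at \<open>b\<close> strictly above
    \<open>?k\<close>.\<close>
  moreover have "?N p \<le> ?N c"
    using c by (intro N_interval_antimono) (simp add: supp_def)
  ultimately show False using exponent[of b] outside[OF b(2)] by linarith
qed

theorem theorem5p1:
  fixes n :: nat
  assumes "atomic_lattice TYPE('p::finite_lattice_complete)"
    and "card (atoms :: 'p set) = n"
    and "n \<noteq> 1"
    and "\<And>p::'p. p \<notin> atoms \<union> {bot} \<Longrightarrow>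
           \<exists>ai\<in>supp p. \<exists>aj\<in>supp p. p = sup ai aj \<and>
             (\<exists>ar\<in>{ai, aj}. \<forall>ak\<in>atoms - supp p.
                N_interval (sup ar ak) Orderings.top < N_interval p Orderings.top)"
  shows "weak_coordinatization TYPE('k::field) (atoms :: 'p set) support_labeling"
proof (rule weak_coordinatizationI[OF assms(1) labeling_support_labeling])
  fix a p :: 'p
  assume a: "a \<in> atoms" "\<not> a \<le> p"
  have atom_case: "\<not> triangle support_labeling a \<subseteq># Sup (triangle support_labeling ` supp c)"
    if "c \<in> atoms" "\<not> a \<le> c" for c
  proof (rule triangle_separation[OF assms(1) a(1) that(2), of c])
    show "c \<in> supp c" using that(1) by (simp add: supp_atom)
    fix b assume "b \<in> atoms - supp c"
    \<comment> \<open>An atom outside \<open>supp c\<close> is not below \<open>c\<close>, so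
      joining it moves strictly up and loses \<open>c\<close> from the interval.\<close>
    then have "c < sup c b"
      by (metis DiffE mem_Collect_eq supp_def sup.cobounded1 sup.cobounded2 le_less)
    then show "N_interval (sup c b) Orderings.top < N_interval c Orderings.top"
      by (rule N_interval_strict_antimono)
  qed
  consider "p = bot" | "p \<in> atoms" | "p \<notin> atoms \<union> {bot}" by blast
  then show "\<not> triangle support_labeling a \<subseteq># Sup (triangle support_labeling ` supp p)"
  proof cases
    case 1
    \<comment> \<open>Here the lcm is empty, so \<open>triangle support_labeling a\<close> must
      differ from 1. A second atom, available as \<open>n \<noteq> 1\<close>, gives this through the
      atom case; with a single atom, x(a) is the label of \<open>bot\<close>, hence 1, and the
      separation fails.\<close>
    have "\<not> (atoms :: 'p set) \<subseteq> {a}"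
      using assms(2,3) a(1) by (metis empty_iff is_singletonI is_singleton_altdef subset_singletonD)
    then obtain c where c: "c \<in> atoms" "c \<noteq> a" by blast
    then have "\<not> triangle support_labeling a \<subseteq># Sup (triangle support_labeling ` supp c)"
      using a(1) atom_case atom_le_atom by blast
    then have "triangle support_labeling a \<noteq> {#}" by auto
    then show ?thesis by (simp add: 1 supp_bot Sup_multiset_empty)
  next
    case 2
    then show ?thesis using atom_case a(2) by blast
  next
    case 3
    \<comment> \<open>\<open>c\<close> is the fixed atom \<open>ar\<close> from the hypothesis on
      \<open>p\<close>.\<close>
    then obtain c where "c \<in> supp p"
      "\<forall>b\<in>atoms - supp p. N_interval (sup c b) Orderings.top < N_interval p Orderings.top"
      using assms(4) by blast
    then show ?thesis using triangle_separation[OF assms(1) a, of c] by blast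
  qed
qed

end
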